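(* Let $\mathcal F=\{a_1,\dots,a_s\}$ and $\mathcal R=\{r_1(m_1),\dots,r_\ell(m_\ell)\}$ be the collections of forbidden and repeated words respectively, over a symbol set $\Sigma$ of size $q\ge2$, where $m_j>1$ for all $1\le j\le\ell$, and suppose that $\mathcal F\cup\mathcal R$ is reduced. Then the generating function $F(z)=\sum_{n\ge0}f(n)z^{-n}$ takes the following form of a rational function: $$F(z)=\frac{z}{z-q+z\sum_{i=1}^{\ell}\bigl(1-\frac1{m_i}\bigr)R_i(z)-z\sum_{j=1}^{s}R_{\ell+j}(z)},$$ where $R_i(z)$ is the $i$-th row sum of $P^{-1}(z)$.
   Context: $\Sigma$ is a finite set of $q$ symbols; a word is a finite sequence over $\Sigma$ and $|w|$ is its length. A finite collection of words is reduced if for any two distinct words in it, neither is a (contiguous) subword of the other. $\mathcal F$ is a finite reduced collection of words of length at least $2$, and $\Sigma_{\mathcal F}$ is the set of all one-sided infinite sequences over $\Sigma$ that contain no word of $\mathcal F$ as a subword. A word is allowed if it is a subword of some sequence in $\Sigma_{\mathcal F}$; $\mathcal L_n$ is the set of allowed words of length $n$. It is assumed that every symbol of $\Sigma$ is allowed and that $\Sigma_{\mathcal F}$ is irreducible, that is, if $p_0$ is the length of the longest word in $\mathcal F$, the following binary matrix $B$ indexed by $\mathcal L_{p_0-1}$ is irreducible (for all $X,Y$ some power $B^m$ has positive $XY$ entry): $B_{XY}=1$ if the last $p_0-2$ symbols of $X$ are the first $p_0-2$ symbols of $Y$ and the word formed by $X$ followed by the last symbol of $Y$ lies in $\mathcal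 L_{p_0}$, and $B_{XY}=0$ otherwise. $\mathcal R$ is a finite reduced collection of allowed words $r_1,\dots,r_\ell$, each $r_j$ being assigned an integer multiplicity $m_j\ge2$. For an allowed word $w$ put $m(w)=\prod_{j=1}^{\ell}m_j^{n(w;r_j)}$, where $n(w;r_j)$ is the number of occurrences of $r_j$ as a subword of $w$. For $n\ge1$, $f(n)=\sum_{w\in\mathcal L_n}m(w)$, and by convention $f(0)=1$. Correlation: for words $u,v$, $(u,v)=(c_1,\dots,c_{|u|})$, where $c_i=1$ if, on placing $v$ below $u$ so that the leftmost symbol of $v$ lies under the $i$-th symbol of $u$ from the left, the overlapping segments of $u$ and $v$ are identical, and $c_i=0$ otherwise; the correlation polynomial is $(u,v)_z=\sum_{i=1}^{|u|}c_iz^{|u|-i}$. $P(z)=[P(z)_{ij}]_{1\le i,j\le\ell+s}$ is the matrix function with $$P(z)_{ij}=\begin{cases}z(1-\frac1{m_j})(r_j,r_i)_z-\delta_{ij}z^{|r_j|}, & 1\le i,j\le\ell,\\ -z(a_{j-\ell},r_i)_z, & 1\le i\le\ell,\ \ell+1\le j\le\ell+s,\\ z(1-\frac1{m_j})(r_j,a_{i-\ell})_z, & \ell+1\le i\le\ell+s,\ 1\le j\le\ell,\\ -z(a_{j-\ell},a_{i-\ell})_z, & \ell+1\le i,j\le\ell+s,\end{cases}$$ where $\delta_{ij}=1$ if $i=j$ and $\delta_{ij}=0$ otherwise; $P^{-1}(z)$ is its inverse as a matrix of rational functions.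
   Formalization: Adds the hypothesis that every word containing no forbidden word is allowed; without it the formula fails (Σ={0,1}, F={000,001}, R={11} with m=2: f(2)=4 but the formula gives 5). Repeated words are also taken to be nonempty. *)

theory Defs
  imports
    "HOL-Library.Cardinality"
    "HOL-Library.Sublist"
    "HOL-Computational_Algebra.Computational_Algebra"
    "Jordan_Normal_Form.Matrix"
begin

text \<open>
  The alphabet is a finite type \<open>'a\<close>; words are lists and one-sided infinite sequences are
  functions \<open>nat \<Rightarrow> 'a\<close>. A subword is the library's contiguous \<^const>\<open>sublist\<close>.
\<close>

definition reduced :: "'a list set \<Rightarrow> bool" where
  "reduced W \<longleftrightarrow> finite W \<and> (\<forall>u\<in>W. \<forall>v\<in>W. u \<noteq> v \<longrightarrow> \<not> sublist u v)"

definition occurs_in :: "'a list \<Rightarrow> (nat \<Rightarrow> 'a) \<Rightarrow> bool" where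
  "occurs_in w x \<longleftrightarrow> (\<exists>i. \<forall>k<length w. x (i + k) = w ! k)"

definition shift_space :: "'a list set \<Rightarrow> (nat \<Rightarrow> 'a) set" where
  "shift_space F = {x. \<forall>a\<in>F. \<not> occurs_in a x}"

definition allowed :: "'a list set \<Rightarrow> 'a list \<Rightarrow> bool" where
  "allowed F w \<longleftrightarrow> (\<exists>x\<in>shift_space F. occurs_in w x)"

definition lang :: "'a list set \<Rightarrow> nat \<Rightarrow> 'a list set" where
  "lang F n = {w. length w = n \<and> allowed F w}"

text \<open>
  \<open>p\<^sub>0\<close>. The value 2 for empty \<open>F\<close> is a convention: for the full shift the matrix \<open>B\<close> below is then
  indexed by the symbols.
\<close>

definition longest :: "'a list set \<Rightarrow> nat" where
  "longest F = (if F = {} then 2 else Max (length ` F))"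

definition adj :: "'a list set \<Rightarrow> 'a list \<Rightarrow> 'a list \<Rightarrow> nat" where
  "adj F X Y =
     (if drop (length X - (longest F - 2)) X = take (longest F - 2) Y
         \<and> X @ [last Y] \<in> lang F (longest F)
      then 1 else 0)"

text \<open>Powers of a square matrix whose rows and columns are indexed by a finite set \<open>S\<close>.\<close>

primrec matpow :: "'b set \<Rightarrow> ('b \<Rightarrow> 'b \<Rightarrow> nat) \<Rightarrow> nat \<Rightarrow> 'b \<Rightarrow> 'b \<Rightarrow> nat" where
  "matpow S B 0 = (\<lambda>X Y. if X = Y then 1 else 0)"
| "matpow S B (Suc n) = (\<lambda>X Y. \<Sum>Z\<in>S. matpow S B n X Z * B Z Y)"

definition irreducible_shift :: "'a list set \<Rightarrow> bool" where
  "irreducible_shift F \<longleftrightarrow>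
     (\<forall>X\<in>lang F (longest F - 1). \<forall>Y\<in>lang F (longest F - 1).
        \<exists>n\<ge>1. 0 < matpow (lang F (longest F - 1)) (adj F) n X Y)"

definition occurrences :: "'a list \<Rightarrow> 'a list \<Rightarrow> nat" where
  "occurrences w r = card {i. i + length r \<le> length w \<and> take (length r) (drop i w) = r}"

text \<open>
  Lists enumerate the collections, with indices starting at 0: \<open>R ! j\<close> is the word
  \<open>r\<^bsub>j+1\<^esub>\<close> and \<open>m j\<close> its multiplicity.
\<close>

definition weight :: "'a list list \<Rightarrow> (nat \<Rightarrow> nat) \<Rightarrow> 'a list \<Rightarrow> nat" where
  "weight R m w = (\<Prod>j<length R. m j ^ occurrences w (R ! j))"

definition weighted_count :: "'a list set \<Rightarrow> 'a list list \<Rightarrow> (nat \<Rightarrow> nat) \<Rightarrow> nat \<Rightarrow> nat" where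
  "weighted_count F R m n = (if n = 0 then 1 else \<Sum>w\<in>lang F n. weight R m w)"

text \<open>
  Position \<open>i\<close> (counted from 1) of the correlation: \<open>v\<close> starts below the \<open>i\<close>-th symbol of \<open>u\<close>, and may
  either stick out to the right of \<open>u\<close> or end inside it.
\<close>

definition corr :: "'a list \<Rightarrow> 'a list \<Rightarrow> nat \<Rightarrow> bool" where
  "corr u v i \<longleftrightarrow> take (length v) (drop (i - 1) u) = take (length (drop (i - 1) u)) v"

type_synonym ratfun = "complex poly fract"

text \<open>The identity function \<open>z\<close>, i.e. the indeterminate of the rational function field.\<close>

definition Z :: ratfun where
  "Z = Fract [:0, 1:] 1"

definition corr_poly :: "'a list \<Rightarrow> 'a list \<Rightarrow> ratfun" where
  "corr_poly u v = (\<Sum>i=1..length u. (if corr u v i then 1 else 0) * Z ^ (length u - i))"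

definition P_mat :: "'a list list \<Rightarrow> 'a list list \<Rightarrow> (nat \<Rightarrow> nat) \<Rightarrow> ratfun mat" where
  "P_mat A R m =
     (let l = length R; s = length A in
      mat (l + s) (l + s) (\<lambda>(i, j).
        if i < l \<and> j < l then
          Z * (1 - 1 / of_nat (m j)) * corr_poly (R ! j) (R ! i)
            - (if i = j then 1 else 0) * Z ^ length (R ! j)
        else if i < l then - Z * corr_poly (A ! (j - l)) (R ! i)
        else if j < l then Z * (1 - 1 / of_nat (m j)) * corr_poly (R ! j) (A ! (i - l))
        else - Z * corr_poly (A ! (j - l)) (A ! (i - l))))"

definition row_sum :: "'b::comm_monoid_add mat \<Rightarrow> nat \<Rightarrow> 'b" where
  "row_sum M i = (\<Sum>j<dim_col M. M $$ (i, j))"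

text \<open>
  Generating functions in \<open>1/z\<close> are formal Laurent series whose indeterminate \<^const>\<open>fls_X\<close> stands
  for \<open>1/z\<close>, so \<open>z\<close> is \<^const>\<open>fls_X_inv\<close>. The field embedding \<open>expand_at_infinity\<close> sends a rational
  function of \<open>z\<close> to its Laurent expansion at \<open>z = \<infinity>\<close>.
\<close>

definition poly_at_infinity :: "complex poly \<Rightarrow> complex fls" where
  "poly_at_infinity p = (\<Sum>i\<le>degree p. fls_const (coeff p i) * fls_X_inv ^ i)"

lemma poly_at_infinity_conv_poly:
  "poly_at_infinity p = poly (map_poly fls_const p) fls_X_inv"
  unfolding poly_at_infinity_def
  by (subst poly_altdef, subst degree_map_poly) (auto simp: coeff_map_poly)

lemma poly_at_infinity_mult:
  "poly_at_infinity (p * q) = poly_at_infinity p * poly_at_infinity q"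
proof -
  have "fls_const (\<Sum>i\<in>S. g i) = (\<Sum>i\<in>S. fls_const (g i))"
    for g :: "nat \<Rightarrow> complex" and S
    by (rule fls_eqI) (simp add: fls_nth_sum)
  then have "map_poly fls_const (p * q) = map_poly fls_const p * map_poly fls_const q"
    by (intro poly_eqI) (simp add: coeff_map_poly coeff_mult)
  then show ?thesis
    by (simp add: poly_at_infinity_conv_poly)
qed

lemma fls_nth_poly_at_infinity: "fls_nth (poly_at_infinity p) (- int n) = coeff p n"
proof -
  have "fls_nth (poly_at_infinity p) (- int n) = (\<Sum>i\<le>degree p. if i = n then coeff p i else 0)"
    unfolding poly_at_infinity_def fls_nth_sum by (intro sum.cong) auto
  then show ?thesis
    by (auto simp: coeff_eq_0)
qed

lemma poly_at_infinity_nonzero: "p \<noteq> 0 \<Longrightarrow> poly_at_infinity p \<noteq> 0"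
  by (metis fls_nth_poly_at_infinity fls_zero_nth poly_eqI coeff_0)

definition expand_at_infinity :: "ratfun \<Rightarrow> complex fls" where
  "expand_at_infinity r =
     (THE y. \<exists>p q. q \<noteq> 0 \<and> r = Fract p q \<and> y = poly_at_infinity p / poly_at_infinity q)"

lemma expand_at_infinity_Fract:
  assumes "q \<noteq> 0"
  shows "expand_at_infinity (Fract p q) = poly_at_infinity p / poly_at_infinity q"
proof -
  have "poly_at_infinity p' / poly_at_infinity q' = poly_at_infinity p / poly_at_infinity q"
    if "q' \<noteq> 0" "Fract p q = Fract p' q'" for p' q'
    using that assms
    by (simp add: eq_fract frac_eq_eq poly_at_infinity_nonzero flip: poly_at_infinity_mult)
  then show ?thesis
    unfolding expand_at_infinity_def using assms by (intro the_equality) blast+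
qed

definition gen_fun :: "(nat \<Rightarrow> nat) \<Rightarrow> complex fls" where
  "gen_fun f = fps_to_fls (Abs_fps (\<lambda>n. of_nat (f n)))"

end

theory Submission
  imports Defs "Jordan_Normal_Form.Determinant"
begin

text \<open>
  Give every word, forbidden subwords or not, the weight \<open>\<Prod> \<mu>\<^sub>j ^ occurrences\<close>, where \<open>\<mu>\<^sub>j\<close> is the
  multiplicity of a repeated word and 0 for a forbidden word; then \<open>f n\<close> is the total weight of all
  words of length \<open>n\<close>. Let \<open>g\<^sub>j n\<close> be the total weight, before the last letter is appended, of the
  words of length \<open>n\<close> ending in the \<open>j\<close>-th word. Since at most one listed word ends at a given
  position, appending a letter gives \<open>f (n + 1) = q f n + \<Sum>\<^sub>j (\<mu>\<^sub>j - 1) g\<^sub>j (n + 1)\<close>. Appending the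
  \<open>i\<close>-th word letter by letter and telescoping the change of weight expresses \<open>f\<close> through the \<open>g\<^sub>j\<close>
  with correlations as coefficients: up to column scaling, \<open>P\<close> maps the generating functions of
  the \<open>g\<^sub>j\<close> to the constant vector \<open>- F\<close>. Inverting \<open>P\<close> and substituting into the first equation
  gives \<open>F\<close>.
\<close>

section \<open>Occurrences and correlations\<close>

lemma occurrences_snoc:
  assumes "r \<noteq> []"
  shows "occurrences (w @ [x]) r = occurrences w r + of_bool (suffix r (w @ [x]))"
proof -
  let ?O = "\<lambda>w. {i. i + length r \<le> length w \<and> take (length r) (drop i w) = r}"
  \<comment> \<open>Start of the only possible new occurrence. Truncated subtraction makes it 0 when
    \<open>r\<close> is longer than \<open>w @ [x]\<close>; the length conjunct in
    \<open>suf\<close> covers that case.\<close>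
  let ?k = "Suc (length w) - length r"
  have fin: "finite (?O w)"
    by (rule finite_subset[of _ "{..length w}"]) auto
  have suf: "suffix r (w @ [x]) \<longleftrightarrow> length r \<le> Suc (length w) \<and> drop ?k (w @ [x]) = r"
  proof
    assume "suffix r (w @ [x])"
    then obtain ps where "w @ [x] = ps @ r" by (auto simp: suffix_def)
    moreover from this have "Suc (length w) = length ps + length r"
      by (metis length_append length_append_singleton)
    ultimately show "length r \<le> Suc (length w) \<and> drop ?k (w @ [x]) = r" by simp
  next
    assume "length r \<le> Suc (length w) \<and> drop ?k (w @ [x]) = r"
    then show "suffix r (w @ [x])" by (metis suffix_drop)
  qed
  have "?O (w @ [x]) = ?O w \<union> (if suffix r (w @ [x]) then {?k} else {})" (is "?L = ?U")
  proof (rule Set.set_eqI)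
    fix i
    show "i \<in> ?L \<longleftrightarrow> i \<in> ?U"
    proof (cases "i + length r \<le> length w")
      case True
      then show ?thesis by auto
    next
      case False
      have "i \<in> ?L \<longleftrightarrow> i = ?k \<and> suffix r (w @ [x])"
      proof
        assume i: "i \<in> ?L"
        then have "i = ?k" "length r \<le> Suc (length w)" using False by auto
        moreover from this i have "drop i (w @ [x]) = r"
          by (simp del: drop_append)
        ultimately show "i = ?k \<and> suffix r (w @ [x])" using suf by simp
      next
        assume "i = ?k \<and> suffix r (w @ [x])"
        then show "i \<in> ?L" using suf by (simp del: drop_append)
      qed
      then show ?thesis using False by auto
    qed
  qed
  moreover have "?k \<notin> ?O w"
    using assms by (cases r) auto
  ultimately show ?thesis
    using fin by (simp add: occurrences_def)
qed

lemma occurrences_Nil: "r \<noteq> [] \<Longrightarrow> occurrences [] r = 0"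
  by (simp add: occurrences_def)

lemma occurrences_eq_0_iff: "occurrences w r = 0 \<longleftrightarrow> \<not> sublist r w"
proof -
  let ?O = "{i. i + length r \<le> length w \<and> take (length r) (drop i w) = r}"
  have "finite ?O"
    by (rule finite_subset[of _ "{..length w}"]) auto
  moreover have "?O \<noteq> {} \<longleftrightarrow> sublist r w"
  proof
    assume "?O \<noteq> {}"
    then obtain i where "take (length r) (drop i w) = r" by auto
    then show "sublist r w"
      by (metis sublist_drop sublist_take sublist_order.order_trans)
  next
    assume "sublist r w"
    then obtain ps ss where "w = ps @ r @ ss" by (auto simp: sublist_def)
    then have "length ps \<in> ?O" by simp
    then show "?O \<noteq> {}" by blast
  qed
  ultimately show ?thesis by (auto simp: occurrences_def)
qed

text \<open>If \<open>v\<close> does not end strictly inside \<open>u\<close>, the overlap is a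
  prefix of \<open>v\<close> of length \<open>Suc (length u - i)\<close> that is a suffix of
  \<open>u\<close>. If it did, \<open>v\<close> would be a shorter subword of \<open>u\<close>,
  which the last assumption excludes.\<close>

lemma corr_iff_suffix_take:
  assumes "1 \<le> i" "i \<le> length u" "u = v \<or> \<not> sublist v u"
  shows "corr u v i \<longleftrightarrow> length u - i < length v \<and> suffix (take (Suc (length u - i)) v) u"
proof -
  have len: "length (drop (i - 1) u) = Suc (length u - i)" using assms by simp
  show ?thesis
  proof (cases "length u - i < length v")
    case True
    have "corr u v i \<longleftrightarrow> drop (i - 1) u = take (Suc (length u - i)) v"
      using True len by (simp add: corr_def)
    also have "\<dots> \<longleftrightarrow> suffix (take (Suc (length u - i)) v) u"
    proof
      assume "drop (i - 1) u = take (Suc (length u - i)) v"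
      then show "suffix (take (Suc (length u - i)) v) u"
        by (metis suffix_drop)
    next
      assume "suffix (take (Suc (length u - i)) v) u"
      then obtain ps where u: "u = ps @ take (Suc (length u - i)) v" by (auto simp: suffix_def)
      moreover from this have "length u = length ps + Suc (length u - i)"
        using True by (metis Suc_leI length_append length_take min.absorb2)
      then have "length ps = i - 1" using assms by simp
      ultimately show "drop (i - 1) u = take (Suc (length u - i)) v"
        by (metis append_eq_conv_conj)
    qed
    finally show ?thesis using True by simp
  next
    case False
    then have "length v \<le> length u - i" by simp
    then have "u \<noteq> v" using assms by auto
    have "\<not> corr u v i"
    proof
      assume "corr u v i"
      then have "take (length v) (drop (i - 1) u) = v"
        using False len by (simp add: corr_def)
      then have "sublist v u"
        by (metis sublist_drop sublist_take sublist_order.order_trans)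
      then show False using assms \<open>u \<noteq> v\<close> by simp
    qed
    then show ?thesis using False by simp
  qed
qed

section \<open>Sums over all words of a fixed length\<close>

abbreviation words :: "nat \<Rightarrow> 'a list set" where
  "words n \<equiv> {w. length w = n}"

lemma finite_words [simp]: "finite (words n :: 'a::finite list set)"
  using finite_lists_length_eq[of "UNIV :: 'a set" n] by simp

lemma sum_words_Suc:
  fixes h :: "'a::finite list \<Rightarrow> 'b::comm_monoid_add"
  shows "(\<Sum>y\<in>words (Suc n). h y) = (\<Sum>u\<in>words n. \<Sum>x\<in>UNIV. h (u @ [x]))"
  unfolding sum.cartesian_product
  by (rule sum.reindex_bij_witness[where i = "\<lambda>(u, x). u @ [x]" and j = "\<lambda>y. (butlast y, last y)"])
    (auto intro!: arg_cong[where f = h] append_butlast_last_id)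

text \<open>All cross terms vanish when the product is expanded. This turns the multiplicative
  change of weight into a sum over the listed words.\<close>

lemma prod_if_at_most_one:
  fixes c :: "'i \<Rightarrow> 'b::comm_ring_1"
  assumes "finite I" "\<And>i j. i \<in> I \<Longrightarrow> j \<in> I \<Longrightarrow> P i \<Longrightarrow> P j \<Longrightarrow> i = j"
  shows "(\<Prod>i\<in>I. if P i then c i else 1) = 1 + (\<Sum>i\<in>I. if P i then c i - 1 else 0)"
proof (cases "\<exists>i\<in>I. P i")
  case True
  then obtain i where i: "i \<in> I" "P i" by blast
  then have "\<And>j. j \<in> I \<Longrightarrow> P j \<longleftrightarrow> j = i" using assms(2) by blast
  then have "(\<Prod>j\<in>I. if P j then c j else 1) = (\<Prod>j\<in>I. if j = i then c j else 1)"
    and "(\<Sum>j\<in>I. if P j then c j - 1 else 0) = (\<Sum>j\<in>I. if j = i then c j - 1 else 0)"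
    by (auto intro!: prod.cong sum.cong)
  then show ?thesis using i assms(1) by simp
qed (simp cong: prod.cong sum.cong)

section \<open>Weighted words over an antichain\<close>

text \<open>\<open>antichain\<close> concludes equality of indices, so it also rules out repetitions
  in the list. The multiplicities are unrestricted, so that 0 can mark forbidden words.\<close>

locale weighted_words =
  fixes W :: "'a::finite list list" and \<mu> :: "nat \<Rightarrow> 'b::comm_ring_1"
  assumes nonempty: "j < length W \<Longrightarrow> W ! j \<noteq> []"
    and antichain: "i < length W \<Longrightarrow> j < length W \<Longrightarrow> sublist (W ! i) (W ! j) \<Longrightarrow> i = j"
begin

definition wt :: "'a list \<Rightarrow> 'b" where
  "wt w = (\<Prod>j<length W. \<mu> j ^ occurrences w (W ! j))"

definition wt_sum :: "nat \<Rightarrow> 'b" where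
  "wt_sum n = (\<Sum>w\<in>words n. wt w)"

text \<open>The weight omits the final occurrence of \<open>W ! j\<close>, so that multiplicity 0 loses no information.\<close>
definition ending :: "nat \<Rightarrow> nat \<Rightarrow> 'b" where
  "ending j n = (\<Sum>y\<in>words n. if suffix (W ! j) y then wt (butlast y) else 0)"

lemma wt_Nil: "wt [] = 1"
  by (simp add: wt_def occurrences_Nil nonempty)

lemma wt_sum_0: "wt_sum 0 = 1"
  by (simp add: wt_sum_def wt_Nil)

text \<open>Two suffixes of one word are comparable, and distinct listed words are not.\<close>

lemma suffix_unique:
  "i < length W \<Longrightarrow> j < length W \<Longrightarrow> suffix (W ! i) y \<Longrightarrow> suffix (W ! j) y \<Longrightarrow> i = j"
  using antichain suffix_same_cases suffix_imp_sublist by metis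

text \<open>The new letter completes at most one listed word, so the weight changes by a single
  factor \<open>\<mu> j\<close> or not at all.\<close>

lemma wt_snoc:
  "wt (u @ [x]) = wt u + (\<Sum>j<length W. (\<mu> j - 1) * (if suffix (W ! j) (u @ [x]) then wt u else 0))"
proof -
  have "wt (u @ [x]) = wt u * (\<Prod>j<length W. if suffix (W ! j) (u @ [x]) then \<mu> j else 1)"
    unfolding wt_def prod.distrib[symmetric]
    by (intro prod.cong) (auto simp: occurrences_snoc nonempty power_add simp del: suffix_snoc)
  also have "\<dots> = wt u * (1 + (\<Sum>j<length W. if suffix (W ! j) (u @ [x]) then \<mu> j - 1 else 0))"
    by (subst prod_if_at_most_one) (auto intro: suffix_unique simp del: suffix_snoc)
  finally show ?thesis
    by (simp add: ring_distribs sum_distrib_left if_distrib mult.commute cong: if_cong del: suffix_snoc)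
qed

lemma wt_sum_Suc:
  "wt_sum (Suc n) = of_nat CARD('a) * wt_sum n + (\<Sum>j<length W. (\<mu> j - 1) * ending j (Suc n))"
proof -
  have "(\<Sum>u\<in>words n. \<Sum>x\<in>UNIV. \<Sum>j<length W. (\<mu> j - 1) * (if suffix (W ! j) (u @ [x]) then wt u else 0)) =
    (\<Sum>j<length W. (\<mu> j - 1) * ending j (Suc n))"
    unfolding ending_def sum_words_Suc sum_distrib_left butlast_snoc
    by (rule trans[OF sum.cong[OF refl sum.swap] sum.swap])
  then show ?thesis
    unfolding wt_sum_def sum_words_Suc wt_snoc sum.distrib
    by (simp add: sum_distrib_left del: suffix_snoc)
qed

lemma wt_append_diff:
  assumes "t \<le> length v"
  shows "wt (u @ take t v) - wt u =
    (\<Sum>k<t. \<Sum>j<length W. (\<mu> j - 1) *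
       (if suffix (W ! j) (u @ take (Suc k) v) then wt (u @ take k v) else 0))"
  using assms
proof (induction t)
  case (Suc t)
  then have "u @ take (Suc t) v = (u @ take t v) @ [v ! t]"
    by (simp add: take_Suc_conv_app_nth)
  then show ?case
    using Suc wt_snoc[of "u @ take t v" "v ! t"] by (simp del: suffix_snoc)
qed simp

text \<open>The last letter completes \<open>W ! i\<close> and, by \<open>suffix_unique\<close>, no
  other listed word.\<close>

lemma wt_append_word:
  assumes "i < length W"
  shows "wt (u @ W ! i) = \<mu> i * wt (butlast (u @ W ! i))"
proof -
  obtain u' x where u': "u @ W ! i = u' @ [x]"
    by (metis append_is_Nil_conv assms nonempty rev_exhaust)
  have "suffix (W ! j) (u' @ [x]) \<longleftrightarrow> j = i" if "j < length W" for j
    using suffix_unique[OF that assms, of "u' @ [x]"] suffixI[OF u'[symmetric]] by (auto simp del: suffix_snoc)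
  then have "wt (u' @ [x]) = wt u' + (\<Sum>j<length W. if j = i then (\<mu> j - 1) * wt u' else 0)"
    unfolding wt_snoc by (intro arg_cong2[where f = "(+)"] sum.cong) (auto simp del: suffix_snoc)
  then show ?thesis using assms by (simp add: u' algebra_simps)
qed

text \<open>By reducedness, a listed word that ends inside \<open>W ! i\<close> must overlap it in a prefix.\<close>
lemma sum_ending:
  assumes "i < length W" "j < length W" "t < length (W ! i)"
  shows "(\<Sum>u\<in>words n. if suffix (W ! j) (u @ take (Suc t) (W ! i)) then wt (u @ take t (W ! i)) else 0)
    = (if suffix (take (Suc t) (W ! i)) (W ! j) then ending j (n + Suc t) else 0)"
proof -
  let ?p = "take (Suc t) (W ! i)"
  have p: "butlast ?p = take t (W ! i)" "length ?p = Suc t"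
    using assms by (simp_all add: butlast_take)
  have bl: "butlast (u @ ?p) = u @ take t (W ! i)" for u
    using p by (metis butlast_append length_0_conv nat.simps(3))
  show ?thesis
  proof (cases "suffix ?p (W ! j)")
    case True
    have "ending j (n + Suc t) =
      (\<Sum>y\<in>{y \<in> words (n + Suc t). suffix (W ! j) y}. wt (butlast y))"
      unfolding ending_def by (rule sum.inter_filter[symmetric]) simp
    \<comment> \<open>Every word ending in \<open>W ! j\<close> ends in its suffix
      \<open>?p\<close>, so cutting off \<open>?p\<close> loses nothing.\<close>
    also have "\<dots> = (\<Sum>u\<in>{u \<in> words n. suffix (W ! j) (u @ ?p)}. wt (u @ take t (W ! i)))"
    proof (rule sum.reindex_bij_witness[where i = "\<lambda>u. u @ ?p" and j = "take n"], goal_cases)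
      case (1 y)
      then have "suffix ?p y" using True suffix_order.order_trans by auto
      then obtain u where "y = u @ ?p" by (auto simp: suffix_def)
      then show ?case using 1 p by simp
    next
      case (2 y)
      then have "suffix ?p y" using True suffix_order.order_trans by auto
      then obtain u where "y = u @ ?p" by (auto simp: suffix_def)
      then show ?case using 2 p by simp
    next
      case (5 y)
      then have "suffix ?p y" using True suffix_order.order_trans by auto
      then obtain u where "y = u @ ?p" by (auto simp: suffix_def)
      then show ?case using 5 p bl by simp
    qed (use p in auto)
    also have "\<dots> = (\<Sum>u\<in>words n. if suffix (W ! j) (u @ ?p) then wt (u @ take t (W ! i)) else 0)"
      by (rule sum.inter_filter) simp
    finally show ?thesis using True by simp
  next
    case False
    have "\<not> suffix (W ! j) (u @ ?p)" for u
    proof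
      assume "suffix (W ! j) (u @ ?p)"
      then have s: "suffix (W ! j) ?p"
        using False suffix_same_cases[of "W ! j" "u @ ?p" ?p] suffixI[OF refl, of ?p u] by blast
      then have "sublist (W ! j) (W ! i)"
        by (meson suffix_imp_sublist sublist_take sublist_order.order_trans)
      \<comment> \<open>With \<open>j = i\<close>, the prefix \<open>?p\<close> must have full
        length and equal \<open>W ! i\<close>, contradicting \<open>False\<close>.\<close>
      then have "j = i" using antichain assms by blast
      then show False
        using s False p assms suffix_length_le[OF s] by auto
    qed
    then show ?thesis using False by simp
  qed
qed

text \<open>Double counting of the total weight of the words \<open>u @ W ! i\<close>: the last
  letter gives the term with \<open>\<mu> i\<close>, and telescoping over all appended letters gives
  \<open>wt_sum n\<close> plus the correlation sum.\<close>

lemma wt_sum_eq_ending: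
  assumes i: "i < length W"
  shows "wt_sum n = \<mu> i * ending i (n + length (W ! i)) -
    (\<Sum>j<length W. (\<mu> j - 1) * (\<Sum>k = 1..length (W ! j).
       if corr (W ! j) (W ! i) k then ending j (n + Suc (length (W ! j) - k)) else 0))"
proof -
  let ?v = "W ! i"
  have v: "?v \<noteq> []" "Suc (length ?v - 1) = length ?v" using nonempty i by auto
  \<comment> \<open>An overlap of \<open>Suc t\<close> letters means that \<open>W ! i\<close>
    starts below position \<open>k = length (W ! j) - t\<close> of \<open>W ! j\<close>.\<close>
  have reindex: "(\<Sum>t<length ?v. if suffix (take (Suc t) ?v) (W ! j) then ending j (n + Suc t) else 0) =
      (\<Sum>k = 1..length (W ! j). if corr (W ! j) ?v k then ending j (n + Suc (length (W ! j) - k)) else 0)"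
    (is "?L = ?R") if j: "j < length W" for j
  proof -
    have c: "corr (W ! j) ?v k \<longleftrightarrow> length (W ! j) - k < length ?v \<and>
        suffix (take (Suc (length (W ! j) - k)) ?v) (W ! j)" if "k \<in> {1..length (W ! j)}" for k
      using that antichain[OF i j] by (intro corr_iff_suffix_take) auto
    have "?L = (\<Sum>t\<in>{t \<in> {..<length ?v}. suffix (take (Suc t) ?v) (W ! j)}. ending j (n + Suc t))"
      by (rule sum.inter_filter[symmetric]) simp
    also have "\<dots> = (\<Sum>k\<in>{k \<in> {1..length (W ! j)}. corr (W ! j) ?v k}. ending j (n + Suc (length (W ! j) - k)))"
    proof (rule sum.reindex_bij_witness[where i = "\<lambda>k. length (W ! j) - k" and j = "\<lambda>t. length (W ! j) - t"], goal_cases)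
      case (2 t)
      then have "Suc t \<le> length (W ! j)" using suffix_length_le[of "take (Suc t) ?v"] by auto
      then show ?case using 2 by (auto simp: c)
    next
      case (1 t)
      then have "Suc t \<le> length (W ! j)" using suffix_length_le[of "take (Suc t) ?v"] by auto
      then show ?case by simp
    next
      case (5 t)
      then have "Suc t \<le> length (W ! j)" using suffix_length_le[of "take (Suc t) ?v"] by auto
      then show ?case by simp
    qed (auto simp: c)
    also have "\<dots> = ?R"
      by (rule sum.inter_filter) simp
    finally show ?thesis .
  qed
  have "(\<Sum>u\<in>words n. wt (u @ ?v)) = \<mu> i * (\<Sum>u\<in>words n. wt (u @ butlast ?v))"
    using v by (simp add: wt_append_word[OF i] butlast_append sum_distrib_left)
  also have "(\<Sum>u\<in>words n. wt (u @ butlast ?v)) = ending i (n + length ?v)"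
    using sum_ending[OF i i, of "length ?v - 1" n] v suffixI[OF refl, of ?v]
    by (simp add: butlast_conv_take)
  finally have *: "(\<Sum>u\<in>words n. wt (u @ ?v)) = \<mu> i * ending i (n + length ?v)" .
  have "(\<Sum>u\<in>words n. wt (u @ ?v)) - wt_sum n = (\<Sum>u\<in>words n. wt (u @ take (length ?v) ?v) - wt u)"
    by (simp add: wt_sum_def sum_subtractf)
  also have "\<dots> = (\<Sum>u\<in>words n. \<Sum>t<length ?v. \<Sum>j<length W. (\<mu> j - 1) *
       (if suffix (W ! j) (u @ take (Suc t) ?v) then wt (u @ take t ?v) else 0))"
    by (intro sum.cong refl wt_append_diff) simp
  also have "\<dots> = (\<Sum>t<length ?v. \<Sum>j<length W. (\<mu> j - 1) * (\<Sum>u\<in>words n.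
       if suffix (W ! j) (u @ take (Suc t) ?v) then wt (u @ take t ?v) else 0))"
    by (subst sum.swap, intro sum.cong refl, subst sum.swap) (simp add: sum_distrib_left)
  also have "\<dots> = (\<Sum>t<length ?v. \<Sum>j<length W. (\<mu> j - 1) *
       (if suffix (take (Suc t) ?v) (W ! j) then ending j (n + Suc t) else 0))"
    by (intro sum.cong refl) (simp add: sum_ending[OF i])
  also have "\<dots> = (\<Sum>j<length W. (\<mu> j - 1) * (\<Sum>t<length ?v.
       if suffix (take (Suc t) ?v) (W ! j) then ending j (n + Suc t) else 0))"
    by (subst sum.swap) (simp add: sum_distrib_left)
  also have "\<dots> = (\<Sum>j<length W. (\<mu> j - 1) * (\<Sum>k = 1..length (W ! j).
       if corr (W ! j) ?v k then ending j (n + Suc (length (W ! j) - k)) else 0))"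
    by (intro sum.cong refl) (simp only: reindex lessThan_iff)
  finally show ?thesis by (simp add: * algebra_simps)
qed

lemma ending_eq_0: "n < length (W ! j) \<Longrightarrow> ending j n = 0"
  unfolding ending_def by (intro sum.neutral) (auto dest: suffix_length_le)

end

section \<open>Generating functions\<close>

lemma poly_at_infinity_add: "poly_at_infinity (p + q) = poly_at_infinity p + poly_at_infinity q"
proof -
  have "map_poly fls_const (p + q) = map_poly fls_const p + map_poly fls_const q"
    by (intro poly_eqI) (simp add: coeff_map_poly fls_plus_const)
  then show ?thesis by (simp add: poly_at_infinity_conv_poly)
qed

lemma poly_at_infinity_0 [simp]: "poly_at_infinity 0 = 0"
  and poly_at_infinity_1 [simp]: "poly_at_infinity 1 = 1"
  by (simp_all add: poly_at_infinity_conv_poly map_poly_1)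

text \<open>Sums, quotients and determinants of rational functions can thus be carried over to
  Laurent series.\<close>

interpretation expand_at_infinity: field_hom expand_at_infinity
proof
  show "expand_at_infinity 0 = 0" "expand_at_infinity 1 = 1"
    by (simp_all add: Zero_fract_def One_fract_def expand_at_infinity_Fract)
  fix x y :: ratfun
  obtain a b where x: "x = Fract a b" "b \<noteq> 0" by (cases x)
  obtain c d where y: "y = Fract c d" "d \<noteq> 0" by (cases y)
  show "expand_at_infinity (x + y) = expand_at_infinity x + expand_at_infinity y"
    using x y by (simp add: expand_at_infinity_Fract poly_at_infinity_add poly_at_infinity_mult
        poly_at_infinity_nonzero add_frac_eq)
  show "expand_at_infinity (x * y) = expand_at_infinity x * expand_at_infinity y"
    using x y by (simp add: expand_at_infinity_Fract poly_at_infinity_mult)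
qed

lemma expand_at_infinity_Z [simp]: "expand_at_infinity Z = fls_X_inv"
  by (simp add: Z_def expand_at_infinity_Fract poly_at_infinity_def[of "[:0, 1:]"])

text \<open>The factor \<open>Z\<close> raises each exponent to the length of the overlap, which is
  the index shift in \<open>wt_sum_eq_ending\<close>.\<close>

lemma expand_at_infinity_corr_poly:
  "expand_at_infinity (Z * corr_poly u v) =
     (\<Sum>k = 1..length u. if corr u v k then fls_X_inv ^ Suc (length u - k) else 0)"
  by (auto simp: corr_poly_def hom_distribs sum_distrib_left expand_at_infinity.hom_sum intro!: sum.cong)

interpretation fps_nth_0: comm_ring_hom "\<lambda>f :: 'a::comm_ring_1 fps. fps_nth f 0"
  by standard auto

interpretation fps_to_fls: comm_ring_hom "fps_to_fls :: 'a::comm_ring_1 fps \<Rightarrow> 'a fls"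
  by standard (auto simp: fls_times_fps_to_fls)

section \<open>Generating-function form of the two recurrences\<close>

context weighted_words
begin

abbreviation total_gf :: "'b fls" where
  "total_gf \<equiv> fps_to_fls (Abs_fps wt_sum)"

abbreviation ending_gf :: "nat \<Rightarrow> 'b fls" where
  "ending_gf j \<equiv> fps_to_fls (Abs_fps (ending j))"

text \<open>Multiplication by \<open>z ^ k\<close> shifts indices down by \<open>k\<close>; the
  coefficients pushed to negative indices vanish because a word shorter than \<open>W ! j\<close>
  cannot end in it.\<close>

lemma shift_ending_gf:
  assumes "k \<le> length (W ! j)"
  shows "fls_X_inv ^ k * ending_gf j = fps_to_fls (Abs_fps (\<lambda>n. ending j (n + k)))"
proof (rule fls_eqI)
  fix n :: int
  show "fls_nth (fls_X_inv ^ k * ending_gf j) n = fls_nth (fps_to_fls (Abs_fps (\<lambda>n. ending j (n + k)))) n"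
  proof (cases "n < 0")
    case True
    then have "nat (n + int k) < length (W ! j)" if "n + int k \<ge> 0" using that assms by linarith
    then show ?thesis using True
      by (auto simp: fls_X_inv_power_times_conv_shift ending_eq_0)
  next
    case False
    then show ?thesis
      by (simp add: fls_X_inv_power_times_conv_shift nat_add_distrib)
  qed
qed

lemma total_gf_append_letter:
  "fls_X_inv * total_gf = fls_X_inv + of_nat CARD('a) * total_gf
     + fls_X_inv * (\<Sum>j<length W. fls_const (\<mu> j - 1) * ending_gf j)"
proof (rule fls_eqI)
  fix n :: int
  have 0: "ending j 0 = 0" if "j < length W" for j
    using that nonempty by (intro ending_eq_0) auto
  \<comment> \<open>Index -1 carries the initial value \<open>wt_sum 0 = 1\<close>, the source of
    the isolated summand \<open>fls_X_inv\<close>; nonnegative indices are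
    \<open>wt_sum_Suc\<close>.\<close>
  consider "n < - 1" | "n = - 1" | k where "n = int k"
  proof (cases "n \<ge> 0")
    case True
    then show ?thesis using nonneg_int_cases that(3) by blast
  qed (use that in linarith)
  then show "fls_nth (fls_X_inv * total_gf) n = fls_nth (fls_X_inv + of_nat CARD('a) * total_gf
     + fls_X_inv * (\<Sum>j<length W. fls_const (\<mu> j - 1) * ending_gf j)) n"
    by cases (auto simp: fls_X_inv_times_conv_shift fls_nth_sum wt_sum_0 0 fls_of_nat nat_add_distrib wt_sum_Suc)
qed

text \<open>This is \<open>wt_sum_eq_ending\<close> coefficientwise. No shift exceeds the length of
  its word, so no correction terms arise.\<close>

lemma total_gf_append_word:
  assumes i: "i < length W"
  shows "total_gf = fls_const (\<mu> i) * fls_X_inv ^ length (W ! i) * ending_gf i -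
    (\<Sum>j<length W. fls_const (\<mu> j - 1) * (\<Sum>k = 1..length (W ! j).
       if corr (W ! j) (W ! i) k then fls_X_inv ^ Suc (length (W ! j) - k) else 0) * ending_gf j)"
proof -
  have "(\<Sum>k = 1..length (W ! j). if corr (W ! j) (W ! i) k then fls_X_inv ^ Suc (length (W ! j) - k) else 0) * ending_gf j
     = fps_to_fls (Abs_fps (\<lambda>n. \<Sum>k = 1..length (W ! j).
       if corr (W ! j) (W ! i) k then ending j (n + Suc (length (W ! j) - k)) else 0))" (is "_ = fps_to_fls (?E j)") for j
  proof -
    have "fls_X_inv ^ Suc (length (W ! j) - k) * ending_gf j =
        fps_to_fls (Abs_fps (\<lambda>n. ending j (n + Suc (length (W ! j) - k))))"
      if "k \<in> {1..length (W ! j)}" for k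
      using that by (intro shift_ending_gf) auto
    then have "(\<Sum>k = 1..length (W ! j). if corr (W ! j) (W ! i) k then fls_X_inv ^ Suc (length (W ! j) - k) else 0) * ending_gf j
      = fps_to_fls (\<Sum>k = 1..length (W ! j). if corr (W ! j) (W ! i) k
          then Abs_fps (\<lambda>n. ending j (n + Suc (length (W ! j) - k))) else 0)"
      unfolding sum_distrib_right fps_to_fls.hom_sum by (intro sum.cong) auto
    also have "(\<Sum>k = 1..length (W ! j). if corr (W ! j) (W ! i) k
          then Abs_fps (\<lambda>n. ending j (n + Suc (length (W ! j) - k))) else 0) = ?E j"
      by (rule fps_ext) (auto simp: fps_sum_nth intro!: sum.cong)
    finally show ?thesis .
  qed
  then have "fls_const (\<mu> i) * fls_X_inv ^ length (W ! i) * ending_gf i -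
    (\<Sum>j<length W. fls_const (\<mu> j - 1) * (\<Sum>k = 1..length (W ! j).
       if corr (W ! j) (W ! i) k then fls_X_inv ^ Suc (length (W ! j) - k) else 0) * ending_gf j)
    = fps_to_fls (fps_const (\<mu> i) * Abs_fps (\<lambda>n. ending i (n + length (W ! i))) -
        (\<Sum>j<length W. fps_const (\<mu> j - 1) * ?E j))"
    by (simp add: mult.assoc shift_ending_gf fps_to_fls.hom_sum fls_times_fps_to_fls)
  also have "fps_const (\<mu> i) * Abs_fps (\<lambda>n. ending i (n + length (W ! i))) -
        (\<Sum>j<length W. fps_const (\<mu> j - 1) * ?E j) = Abs_fps wt_sum"
    by (rule fps_ext) (simp add: fps_sum_nth wt_sum_eq_ending[OF i])
  finally show ?thesis by simp
qed

end

section \<open>The correlation matrix\<close>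

lemma (in comm_monoid_set) lessThan_add:
  "F g {..<l + s :: nat} = F g {..<l} \<^bold>* F (\<lambda>j. g (l + j)) {..<s}"
  by (induction s) (simp_all add: ac_simps lessThan_Suc)

text \<open>
  With multiplicity \<open>\<mu>\<close> (\<open>m j\<close> for a repeated word, 0 for a forbidden one), \<open>\<mu> - 1\<close> equals the
  coefficient below times \<open>m j\<close> (repeated) or times 1 (forbidden).
\<close>
definition col_coeff :: "nat \<Rightarrow> (nat \<Rightarrow> nat) \<Rightarrow> nat \<Rightarrow> 'k::field" where
  "col_coeff l m j = (if j < l then 1 - 1 / of_nat (m j) else - 1)"

lemma P_mat_carrier: "P_mat A R m \<in> carrier_mat (length R + length A) (length R + length A)"
  by (simp add: P_mat_def Let_def)

text \<open>Listing the words as \<open>R @ A\<close> merges the four blocks, since the prefactor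
  depends on the column only.\<close>

lemma P_mat_index:
  assumes "i < length R + length A" "j < length R + length A"
  shows "P_mat A R m $$ (i, j) =
    col_coeff (length R) m j * (Z * corr_poly ((R @ A) ! j) ((R @ A) ! i))
      - (if i = j \<and> j < length R then Z ^ length ((R @ A) ! j) else 0)"
  using assms by (auto simp: P_mat_def Let_def col_coeff_def nth_append)

lemma expand_at_infinity_col_coeff:
  "expand_at_infinity (col_coeff l m j) = col_coeff l m j"
  by (simp add: col_coeff_def hom_distribs)

lemma expand_at_infinity_P_mat:
  assumes "i < length R + length A" "j < length R + length A"
  shows "expand_at_infinity (P_mat A R m $$ (i, j)) =
    col_coeff (length R) m j * (\<Sum>k = 1..length ((R @ A) ! j).
       if corr ((R @ A) ! j) ((R @ A) ! i) k then fls_X_inv ^ Suc (length ((R @ A) ! j) - k) else 0)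
      - (if i = j \<and> j < length R then fls_X_inv ^ length ((R @ A) ! j) else 0)"
  unfolding P_mat_index[OF assms] expand_at_infinity.hom_minus expand_at_infinity.hom_mult[of "col_coeff _ _ _"]
    expand_at_infinity_corr_poly expand_at_infinity_col_coeff
  by (simp add: expand_at_infinity.hom_power)

lemma fls_const_col_coeff: "fls_const (col_coeff l m j :: complex) = col_coeff l m j"
proof -
  have "fls_const (1 - 1 / x) = fls_const 1 - fls_const 1 / fls_const x" for x :: complex
    by (simp only: fls_minus_const fls_const_divide_const)
  then show ?thesis by (simp add: col_coeff_def fls_of_nat)
qed

text \<open>
  Dividing column \<open>j\<close> by \<open>z\<close> to the power of the length of its word leaves a matrix of power series
  in \<open>1/z\<close>, and reducedness makes its value at \<open>z = \<infinity>\<close> diagonal with nonzero entries.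
\<close>
lemma det_P_mat_nonzero:
  fixes A R :: "'a::finite list list"
  assumes W: "weighted_words (R @ A)" and m: "\<And>j. j < length R \<Longrightarrow> m j \<noteq> 0"
  shows "det (P_mat A R m) \<noteq> 0"
proof -
  \<comment> \<open>The locale assumptions concern only the list, so any multiplicities serve
    here.\<close>
  interpret weighted_words "R @ A" "\<lambda>_. 0 :: complex" by (rule W)
  define W where "W = R @ A"
  define n where "n = length W"
  define N :: "complex fps mat" where
    "N = mat n n (\<lambda>(i, j). fps_const (col_coeff (length R) m j) *
       (\<Sum>k = 1..length (W ! j). if corr (W ! j) (W ! i) k then fps_X ^ (k - 1) else 0)
       - (if i = j \<and> j < length R then 1 else 0))"
  have dim_N [simp]: "dim_row N = n" "dim_col N = n" by (simp_all add: N_def)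
  \<comment> \<open>Position 1 aligns the left ends, so one word is a prefix of the other. Only this
    position contributes to the constant terms of \<open>N\<close>.\<close>
  have corr1: "corr (W ! j) (W ! i) 1 \<longleftrightarrow> i = j" if "i < n" "j < n" for i j
  proof
    assume c: "corr (W ! j) (W ! i) 1"
    show "i = j"
    proof (cases "length (W ! i) \<le> length (W ! j)")
      case True
      then have "take (length (W ! i)) (W ! j) = W ! i" using c by (simp add: corr_def)
      then have "sublist (W ! i) (W ! j)" by (metis sublist_take)
      then show ?thesis using antichain that by (simp add: W_def n_def)
    next
      case False
      then have "take (length (W ! j)) (W ! i) = W ! j" using c by (simp add: corr_def)
      then have "sublist (W ! j) (W ! i)" by (metis sublist_take)
      then show ?thesis using antichain[of j i] that by (simp add: W_def n_def)
    qed
  qed (simp add: corr_def)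
  have N0: "fps_nth (N $$ (i, j)) 0 = (if i = j then col_coeff (length R) m j - (if j < length R then 1 else 0) else 0)"
    if "i < n" "j < n" for i j
  proof -
    have 1: "1 \<le> length (W ! j)" using nonempty[of j] that by (cases "W ! j") (auto simp: W_def n_def)
    have "(\<Sum>k = 1..length (W ! j). fps_nth (if corr (W ! j) (W ! i) k then fps_X ^ (k - 1) else 0) 0)
      = (\<Sum>k = 1..length (W ! j). if k = 1 then (if i = j then 1 else 0) else (0 :: complex))"
      by (intro sum.cong) (auto simp: corr1[OF that, simplified] fps_X_power_nth)
    also have "\<dots> = (if i = j then 1 else 0)" using 1 by simp
    finally show ?thesis using that by (simp add: N_def fps_sum_nth)
  qed
  have "det (map_mat (\<lambda>f. fps_nth f 0) N) = prod_list (diag_mat (map_mat (\<lambda>f. fps_nth f 0) N))"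
    by (rule det_upper_triangular[where n = n]) (auto simp: upper_triangular_def N0 dim_N)
  also have "\<dots> \<noteq> 0"
  proof -
    \<comment> \<open>The entry is \<open>- 1 / m i\<close> for a repeated word and -1 for a
      forbidden one.\<close>
    have "fps_nth (N $$ (i, i)) 0 \<noteq> 0" if "i < n" for i
      using that m[of i] by (auto simp: N0 col_coeff_def)
    then show ?thesis by (auto simp: prod_list_zero_iff diag_mat_def N_def)
  qed
  finally have "fps_nth (det N) 0 \<noteq> 0" by simp
  then have detN: "det N \<noteq> 0" by auto
  \<comment> \<open>\<open>E\<close> undoes the column scaling: \<open>N * E\<close> is the
    expansion of \<open>P\<close>.\<close>
  define E :: "complex fls mat" where "E = mat_diag n (\<lambda>j. fls_X_inv ^ length (W ! j))"
  have "det E = prod_list (diag_mat E)"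
    by (rule det_upper_triangular[where n = n]) (auto simp: E_def mat_diag_def)
  then have detE: "det E \<noteq> 0" by (auto simp: prod_list_zero_iff diag_mat_def E_def mat_diag_def)
  have "map_mat expand_at_infinity (P_mat A R m) = map_mat fps_to_fls N * E"
  proof (rule eq_matI)
    fix i j assume "i < dim_row (map_mat fps_to_fls N * E)" "j < dim_col (map_mat fps_to_fls N * E)"
    then have ij: "i < n" "j < n" by (auto simp: N_def E_def mat_diag_def)
    have "fls_X * fls_X_inv = (1 :: complex fls)"
      by (metis fls_X_nonzero fls_inverse_X right_inverse)
    then have cancel: "fls_X ^ a * fls_X_inv ^ (a + b) = (fls_X_inv ^ b :: complex fls)" for a b
      by (simp add: power_add flip: mult.assoc power_mult_distrib)
    have X: "fls_X ^ (k - 1) * fls_X_inv ^ length (W ! j) = (fls_X_inv ^ Suc (length (W ! j) - k) :: complex fls)"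
      if k: "k \<in> {1..length (W ! j)}" for k
    proof -
      have "length (W ! j) = (k - 1) + Suc (length (W ! j) - k)" using k by auto
      then show ?thesis using cancel by metis
    qed
    have N1: "fps_to_fls (N $$ (i, j)) = col_coeff (length R) m j * (\<Sum>k = 1..length (W ! j).
        if corr (W ! j) (W ! i) k then fls_X ^ (k - 1) else 0)
        - (if i = j \<and> j < length R then 1 else 0)"
      using ij by (simp add: N_def fps_to_fls.hom_sum fls_times_fps_to_fls fls_const_col_coeff
          if_distrib[of fps_to_fls] fps_to_fls_power cong: if_cong)
    have "(map_mat fps_to_fls N * E) $$ (i, j) = fps_to_fls (N $$ (i, j)) * fls_X_inv ^ length (W ! j)"
      unfolding E_def using ij by (subst mat_diag_mult_right[where nr = n]) (auto simp: N_def)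
    also have "\<dots> = col_coeff (length R) m j * (\<Sum>k = 1..length (W ! j).
        (if corr (W ! j) (W ! i) k then fls_X ^ (k - 1) else 0) * fls_X_inv ^ length (W ! j))
        - (if i = j \<and> j < length R then fls_X_inv ^ length (W ! j) else 0)"
      unfolding N1 left_diff_distrib mult.assoc sum_distrib_right by simp
    also have "(\<Sum>k = 1..length (W ! j).
        (if corr (W ! j) (W ! i) k then fls_X ^ (k - 1) else 0) * fls_X_inv ^ length (W ! j)) =
        (\<Sum>k = 1..length (W ! j).
        (if corr (W ! j) (W ! i) k then fls_X_inv ^ Suc (length (W ! j) - k) else 0 :: complex fls))"
      using X by (intro sum.cong) auto
    also have "col_coeff (length R) m j * \<dots> - (if i = j \<and> j < length R then fls_X_inv ^ length (W ! j) else 0)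
      = expand_at_infinity (P_mat A R m $$ (i, j))"
      using ij unfolding W_def n_def length_append by (subst expand_at_infinity_P_mat) simp_all
    finally show "map_mat expand_at_infinity (P_mat A R m) $$ (i, j) = (map_mat fps_to_fls N * E) $$ (i, j)"
      using ij P_mat_carrier[of A R m] by (simp add: n_def W_def)
  qed (use P_mat_carrier[of A R m] in \<open>auto simp: N_def E_def n_def W_def mat_diag_def\<close>)
  then have "expand_at_infinity (det (P_mat A R m)) = fps_to_fls (det N) * det E"
    unfolding expand_at_infinity.hom_det[symmetric] fps_to_fls.hom_det[symmetric]
    by (simp add: det_mult[where n = n] N_def E_def)
  then show ?thesis using detN detE by auto
qed

section \<open>The generating function of the weighted count\<close>

lemma occurs_in_sublist: "occurs_in w x \<Longrightarrow> sublist a w \<Longrightarrow> occurs_in a x"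
proof -
  assume "occurs_in w x" "sublist a w"
  then obtain i ps ss where "w = ps @ a @ ss" "\<forall>k<length w. x (i + k) = w ! k"
    by (auto simp: occurs_in_def sublist_def)
  then have "\<forall>k<length a. x (i + length ps + k) = a ! k"
    by (auto simp: nth_append dest!: spec[of _ "length ps + _"] simp: add.assoc)
  then show "occurs_in a x" by (auto simp: occurs_in_def)
qed

lemma allowed_avoids: "allowed F w \<Longrightarrow> a \<in> F \<Longrightarrow> \<not> sublist a w"
  by (auto simp: allowed_def shift_space_def dest: occurs_in_sublist)

text \<open>Forbidden words get multiplicity 0; \<open>0 ^ 0 = 1\<close> makes them invisible in avoiding words.\<close>
lemma weight_eq_wt:
  fixes A R :: "'a::finite list list" and m :: "nat \<Rightarrow> nat"
  assumes "weighted_words (R @ A)"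
    and avoiding: "\<forall>w. (\<forall>a\<in>set A. \<not> sublist a w) \<longrightarrow> allowed (set A) w"
  shows "weighted_words.wt (R @ A) (\<lambda>j. if j < length R then of_nat (m j) else 0) w =
    (if allowed (set A) w then of_nat (weight R m w) else (0 :: 'b::comm_ring_1))"
proof -
  let ?\<mu> = "\<lambda>j. if j < length R then of_nat (m j) else 0 :: 'b"
  interpret weighted_words "R @ A" ?\<mu> by (rule assms)
  have "wt w = (\<Prod>j<length R. of_nat (m j) ^ occurrences w (R ! j)) *
      (\<Prod>j<length A. 0 ^ occurrences w (A ! j))"
    by (simp add: wt_def prod.lessThan_add nth_append)
  also have "(\<Prod>j<length R. of_nat (m j) ^ occurrences w (R ! j)) = (of_nat (weight R m w) :: 'b)"
    by (simp add: weight_def)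
  also have "(\<Prod>j<length A. 0 ^ occurrences w (A ! j)) = (if allowed (set A) w then 1 else (0 :: 'b))"
  proof (cases "allowed (set A) w")
    case True
    then have "occurrences w (A ! j) = 0" if "j < length A" for j
      using that allowed_avoids[OF True, of "A ! j"] by (simp add: occurrences_eq_0_iff)
    then show ?thesis using True by simp
  next
    case False
    then obtain a where "a \<in> set A" "sublist a w" using avoiding by blast
    then obtain j where "j < length A" "occurrences w (A ! j) \<noteq> 0"
      by (auto simp: in_set_conv_nth occurrences_eq_0_iff)
    then have "(\<Prod>j<length A. 0 ^ occurrences w (A ! j)) = (0 :: 'b)"
      by (intro prod_zero) (auto intro!: bexI[of _ j] simp: power_0_left)
    then show ?thesis using False by simp
  qed
  finally show ?thesis by simp
qed

theorem theorem4p5: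
  fixes A R :: "'a::finite list list" and m :: "nat \<Rightarrow> nat"
  assumes "CARD('a) \<ge> 2"
    and "distinct A" and "\<forall>a\<in>set A. length a \<ge> 2"
    and "\<forall>x. allowed (set A) [x]"
    and "irreducible_shift (set A)"
    and avoiding_words_allowed:
      "\<forall>w. (\<forall>a\<in>set A. \<not> sublist a w) \<longrightarrow> allowed (set A) w"
    and "distinct R" and "\<forall>r\<in>set R. r \<noteq> [] \<and> allowed (set A) r"
    and "\<forall>j<length R. m j \<ge> 2"
    and "reduced (set A \<union> set R)"
  shows "\<exists>Q \<in> carrier_mat (length R + length A) (length R + length A).
    inverts_mat (P_mat A R m) Q \<and> inverts_mat Q (P_mat A R m) \<and>
    gen_fun (weighted_count (set A) R m) =
      expand_at_infinity
        (Z / (Z - of_nat CARD('a)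
              + Z * (\<Sum>i<length R. (1 - 1 / of_nat (m i)) * row_sum Q i)
              - Z * (\<Sum>j<length A. row_sum Q (length R + j))))"
proof -
  define W where "W = R @ A"
  define n where "n = length R + length A"
  define \<mu> :: "nat \<Rightarrow> complex" where "\<mu> = (\<lambda>j. if j < length R then of_nat (m j) else 0)"
  have len_W: "length W = n" by (simp add: W_def n_def)
  \<comment> \<open>\<open>reduced\<close> sees only the union as a set and would permit a word in
    both lists; but repeated words are allowed, hence not forbidden.\<close>
  have "set A \<inter> set R = {}"
    using assms(8) allowed_avoids by blast
  then have dist: "distinct W" using assms by (auto simp: W_def)
  have ww: "weighted_words W"
  proof
    fix i j assume ij: "i < length W" "j < length W" "sublist (W ! i) (W ! j)"
    then have "W ! i \<in> set A \<union> set R" "W ! j \<in> set A \<union> set R"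
      by (metis W_def nth_mem set_append sup_commute)+
    then have "W ! i = W ! j" using assms(10) ij by (auto simp: reduced_def)
    then show "i = j" using dist ij by (simp add: nth_eq_iff_index_eq)
  next
    fix j assume "j < length W"
    then have "W ! j \<in> set A \<union> set R"
      by (metis W_def nth_mem set_append sup_commute)
    then show "W ! j \<noteq> []" using assms(3,8) by fastforce
  qed
  interpret weighted_words W \<mu> by (rule ww)
  have F: "gen_fun (weighted_count (set A) R m) = total_gf"
  proof -
    have "of_nat (weighted_count (set A) R m k) = wt_sum k" for k
    proof (cases "k = 0")
      case False
      \<comment> \<open>By \<open>avoiding_words_allowed\<close>, containing no forbidden word is
        the same as being allowed, so the sum over all words reduces to one over
        \<open>lang\<close>.\<close>
      have "wt_sum k = (\<Sum>w\<in>words k. if allowed (set A) w then of_nat (weight R m w) else 0)"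
        unfolding wt_sum_def
        by (rule sum.cong[OF refl], unfold W_def \<mu>_def,
            rule weight_eq_wt[OF ww[unfolded W_def] avoiding_words_allowed])
      also have "\<dots> = (\<Sum>w\<in>{w \<in> words k. allowed (set A) w}. of_nat (weight R m w))"
        by (rule sum.inter_filter[symmetric]) simp
      finally show ?thesis using False by (simp add: weighted_count_def lang_def)
    qed (simp add: weighted_count_def wt_sum_0)
    then show ?thesis by (simp add: gen_fun_def)
  qed
  have m0: "m j \<noteq> 0" if "j < length R" for j using assms(9) that by fastforce
  have "det (P_mat A R m) \<noteq> 0"
    by (rule det_P_mat_nonzero) (use ww m0 in \<open>auto simp: W_def\<close>)
  then have "P_mat A R m \<in> Units (ring_mat TYPE(ratfun) n ())"
    using P_mat_carrier[of A R m] det_non_zero_imp_unit by (simp add: n_def)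
  then obtain Q where Q: "Q \<in> carrier_mat n n" "Q * P_mat A R m = 1\<^sub>m n" "P_mat A R m * Q = 1\<^sub>m n"
    unfolding Units_def ring_mat_simps by auto
  \<comment> \<open>\<open>P\<close> contains \<open>1 - 1 / m j\<close> where the recurrence has
    \<open>m j - 1\<close>; the missing factor \<open>m j\<close> is moved into the unknown
    \<open>d j * ending_gf j\<close>.\<close>
  define d :: "nat \<Rightarrow> complex fls" where "d = (\<lambda>j. if j < length R then of_nat (m j) else 1)"
  let ?c = "col_coeff (length R) m :: nat \<Rightarrow> complex fls"
  let ?c' = "col_coeff (length R) m :: nat \<Rightarrow> ratfun"
  let ?e = expand_at_infinity
  have c: "fls_const (\<mu> j - 1) = ?c j * d j" for j
    using m0[of j] by (auto simp: \<mu>_def d_def col_coeff_def fls_of_nat field_simps fls_minus_const)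
  \<comment> \<open>Row \<open>i\<close> of the linear system is
    \<open>total_gf_append_word\<close>. For a forbidden word \<open>\<mu> i = 0\<close>, in
    agreement with the absence of a diagonal power of \<open>z\<close>.\<close>
  have P: "(\<Sum>j<n. ?e (P_mat A R m $$ (i, j)) * (d j * ending_gf j)) = - total_gf" if i: "i < n" for i
  proof -
    have "(\<Sum>j<n. ?e (P_mat A R m $$ (i, j)) * (d j * ending_gf j)) =
      (\<Sum>j<n. fls_const (\<mu> j - 1) * (\<Sum>k = 1..length (W ! j).
        if corr (W ! j) (W ! i) k then fls_X_inv ^ Suc (length (W ! j) - k) else 0) * ending_gf j
        - (if j = i then fls_const (\<mu> i) * fls_X_inv ^ length (W ! i) * ending_gf i else 0))"
    proof (rule sum.cong[OF refl])
      fix j assume "j \<in> {..<n}"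
      then have ij: "i < length R + length A" "j < length R + length A" using i by (auto simp: n_def)
      show "?e (P_mat A R m $$ (i, j)) * (d j * ending_gf j) = fls_const (\<mu> j - 1) * (\<Sum>k = 1..length (W ! j).
        if corr (W ! j) (W ! i) k then fls_X_inv ^ Suc (length (W ! j) - k) else 0) * ending_gf j
        - (if j = i then fls_const (\<mu> i) * fls_X_inv ^ length (W ! i) * ending_gf i else 0)"
        unfolding expand_at_infinity_P_mat[OF ij] c W_def[symmetric]
        by (auto simp: algebra_simps d_def \<mu>_def fls_of_nat simp del: power_Suc)
    qed
    also have "\<dots> = - total_gf"
      using i unfolding total_gf_append_word[of i, unfolded len_W, OF i]
      by (simp add: sum_subtractf del: power_Suc)
    finally show ?thesis .
  qed
  \<comment> \<open>The right-hand side has the same entry \<open>- total_gf\<close> in every row,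
    so applying \<open>Q\<close> produces its row sums.\<close>
  have row: "d i * ending_gf i = - total_gf * ?e (row_sum Q i)" if i: "i < n" for i
  proof -
    have QP: "(\<Sum>k<n. Q $$ (i, k) * P_mat A R m $$ (k, j)) = (if i = j then 1 else 0)" if "j < n" for j
      using arg_cong[OF Q(2), of "\<lambda>M. M $$ (i, j)"] i that Q(1) P_mat_carrier[of A R m]
      by (simp add: scalar_prod_def n_def atLeast0LessThan)
    have "- total_gf * ?e (row_sum Q i) = (\<Sum>k<n. ?e (Q $$ (i, k)) * - total_gf)"
      using Q(1) by (simp add: row_sum_def expand_at_infinity.hom_sum sum_distrib_left sum_negf mult.commute)
    also have "\<dots> = (\<Sum>k<n. ?e (Q $$ (i, k)) * (\<Sum>j<n. ?e (P_mat A R m $$ (k, j)) * (d j * ending_gf j)))"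
      by (simp add: P)
    also have "\<dots> = (\<Sum>j<n. ?e (\<Sum>k<n. Q $$ (i, k) * P_mat A R m $$ (k, j)) * (d j * ending_gf j))"
      by (simp add: sum_distrib_left sum_distrib_right expand_at_infinity.hom_sum expand_at_infinity.hom_mult mult.assoc)
        (rule sum.swap)
    also have "\<dots> = (\<Sum>j<n. if j = i then d i * ending_gf i else 0)"
      by (intro sum.cong) (auto simp: QP)
    finally show ?thesis using i by simp
  qed
  define D where "D = Z - of_nat CARD('a)
              + Z * (\<Sum>i<length R. (1 - 1 / of_nat (m i)) * row_sum Q i)
              - Z * (\<Sum>j<length A. row_sum Q (length R + j))"
  have D: "D = Z - of_nat CARD('a) + Z * (\<Sum>j<n. ?c' j * row_sum Q j)"
    unfolding D_def n_def sum.lessThan_add by (simp add: col_coeff_def sum_negf algebra_simps)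
  \<comment> \<open>Replacing row sums by the \<open>ending_gf\<close> turns this product into the
    equation for an appended letter, which leaves just \<open>z\<close>.\<close>
  have "total_gf * ?e D = fls_X_inv * total_gf - of_nat CARD('a) * total_gf
      - fls_X_inv * (\<Sum>j<n. ?c j * (- total_gf * ?e (row_sum Q j)))"
    unfolding D
    by (simp add: hom_distribs expand_at_infinity.hom_sum expand_at_infinity_col_coeff sum_distrib_left
      sum_negf algebra_simps)
  also have "(\<Sum>j<n. ?c j * (- total_gf * ?e (row_sum Q j))) = (\<Sum>j<n. fls_const (\<mu> j - 1) * ending_gf j)"
    by (intro sum.cong) (simp_all add: c mult.assoc row)
  also have "fls_X_inv * total_gf - of_nat CARD('a) * total_gf
      - fls_X_inv * (\<Sum>j<n. fls_const (\<mu> j - 1) * ending_gf j) = fls_X_inv"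
    using total_gf_append_letter by (simp add: len_W)
  finally have FD: "total_gf * ?e D = fls_X_inv" .
  \<comment> \<open>The product is \<open>z\<close>, which is nonzero, so the denominator cannot
    vanish.\<close>
  then have "?e D \<noteq> 0" by auto
  then have "total_gf = ?e (Z / D)"
    using FD by (simp add: hom_distribs eq_divide_eq)
  then show ?thesis
    unfolding F D_def using Q P_mat_carrier[of A R m]
    by (intro bexI[of _ Q]) (auto simp: inverts_mat_def n_def)
qed

end
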